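(* Fix real numbers $1 \le T \le n/2$. For $i \in [n]$, let $v^{(i)} \in \mathbb{R}^n$ be the vector with $i$-th coordinate $1$ and $j$-th coordinate $1/T$ for every $j \ne i$. There exists an absolute constant $c > 0$ such that for every integer $k \le c \cdot n/T$ and every real matrix $A \in \mathbb{R}^{k \times n}$, there exists a subset $S \subset [n]$ of size $n/2$ such that for every $i \in S$ there exists $x \in \mathbb{R}^n$ with $Ax = Av^{(i)}$, all entries of $x$ nonnegative, and $x_i = 0$.
   Context: $[n] = \{1,\dots,n\}$. *)

theory Defs
  imports Complex_Main "Jordan_Normal_Form.Matrix"
begin

text \<open>
  Coordinates are numbered from 0, as usual for \<^typ>\<open>real vec\<close>, so the index set
  \<open>[n]\<close> is \<^term>\<open>{..<n::nat}\<close>.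
\<close>

definition spike_vec :: "nat \<Rightarrow> real \<Rightarrow> nat \<Rightarrow> real vec" where
  "spike_vec n T i = vec n (\<lambda>j. if j = i then 1 else 1 / T)"

end

theory Submission
  imports Defs
begin

text \<open>
  By Farkas' lemma, an index \<open>i\<close> for which no \<open>x\<close> exists comes with a vector \<open>u\<close> in the row space
  of \<open>A\<close> such that, after scaling, \<open>u\<^sub>i = 1\<close> and the other entries have absolute sum below \<open>T\<close>.
  If more than half of the indices were bad, a colouring of them with about \<open>4T\<close> colours
  would make the total off-diagonal weight inside the colour classes at most a quarter of their
  number.  Discarding the few columns of in-class weight at least \<open>1\<close>, some colour class gives
  a strictly diagonally dominant, hence nonsingular, matrix of size of order \<open>n / T\<close>, although
  its rows come from a space of dimension at most \<open>k\<close>.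
\<close>

section \<open>Linear relations and diagonal dominance\<close>

text \<open>Gaussian elimination, by induction on the equations: a pivot \<open>r\<close> for
  equation \<open>p\<close> removes one equation and one unknown, so a surplus of unknowns
  persists.\<close>

lemma underdetermined_nontrivial_solution:
  fixes y :: "'i \<Rightarrow> 'l \<Rightarrow> real"
  assumes "finite L" "finite R" "card L < card R"
  shows "\<exists>\<nu>. (\<exists>i\<in>R. \<nu> i \<noteq> 0) \<and> (\<forall>l\<in>L. (\<Sum>i\<in>R. \<nu> i * y i l) = 0)"
  using assms
proof (induction L arbitrary: R y rule: finite_induct)
  case empty
  then have "R \<noteq> {}" by auto
  then show ?case by (intro exI[of _ "\<lambda>_. 1"]) auto
next
  case (insert p L)
  show ?case
  proof (cases "\<forall>i\<in>R. y i p = 0")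
    case True
    have "card L < card R" using insert.hyps insert.prems by simp
    from insert.IH[OF insert.prems(1) this] True show ?thesis by fastforce
  next
    case False
    then obtain r where r: "r \<in> R" "y r p \<noteq> 0" by auto
    define R' where "R' = R - {r}"
    have R: "R = insert r R'" "r \<notin> R'" "finite R'" using r insert.prems by (auto simp: R'_def)
    then have "card L < card R'" using insert.hyps insert.prems by simp
    from insert.IH[OF R(3) this, of "\<lambda>i l. y i l - y i p / y r p * y r l"]
    obtain \<mu> where \<mu>: "\<exists>i\<in>R'. \<mu> i \<noteq> 0"
      "\<And>l. l \<in> L \<Longrightarrow> (\<Sum>i\<in>R'. \<mu> i * (y i l - y i p / y r p * y r l)) = 0"
      by auto
    define s where "s = (\<Sum>i\<in>R'. \<mu> i * y i p / y r p)"
    \<comment> \<open>Equation \<open>p\<close> forces this value at the pivot; with it, each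
      original sum equals the reduced one.\<close>
    define \<nu> where "\<nu> = \<mu>(r := - s)"
    have eq: "(\<Sum>i\<in>R. \<nu> i * y i l) = (\<Sum>i\<in>R'. \<mu> i * (y i l - y i p / y r p * y r l))" for l
    proof -
      have "(\<Sum>i\<in>R'. \<nu> i * y i l) = (\<Sum>i\<in>R'. \<mu> i * y i l)"
        using R by (intro sum.cong) (auto simp: \<nu>_def)
      then have "(\<Sum>i\<in>R. \<nu> i * y i l) = - s * y r l + (\<Sum>i\<in>R'. \<mu> i * y i l)"
        using R by (simp add: \<nu>_def)
      then show ?thesis
        by (simp add: s_def algebra_simps sum_subtractf sum_distrib_left)
    qed
    have "(\<Sum>i\<in>R. \<nu> i * y i p) = 0" unfolding eq using r by simp
    moreover have "\<exists>i\<in>R. \<nu> i \<noteq> 0" using \<mu>(1) R by (auto simp: \<nu>_def)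
    ultimately show ?thesis using eq \<mu>(2) by (intro exI[of _ \<nu>]) auto
  qed
qed

text \<open>In the column \<open>j\<close> where \<open>\<bar>\<nu> j\<bar>\<close> is largest, the
  off-diagonal terms are too small to cancel the diagonal term unless
  \<open>\<nu> j = 0\<close>.\<close>

lemma strictly_column_dominant_imp_trivial_left_kernel:
  fixes M :: "'i \<Rightarrow> 'i \<Rightarrow> real"
  assumes fin: "finite R" and diag: "\<And>i. i \<in> R \<Longrightarrow> M i i = 1"
    and dom: "\<And>j. j \<in> R \<Longrightarrow> (\<Sum>i\<in>R - {j}. \<bar>M i j\<bar>) < 1"
    and ker: "\<And>j. j \<in> R \<Longrightarrow> (\<Sum>i\<in>R. \<nu> i * M i j) = 0"
    and i: "i \<in> R"
  shows "\<nu> i = 0"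
proof -
  have "Max ((\<lambda>j. \<bar>\<nu> j\<bar>) ` R) \<in> (\<lambda>j. \<bar>\<nu> j\<bar>) ` R"
    using fin i by (intro Max_in) auto
  then obtain j where j: "j \<in> R" "Max ((\<lambda>j. \<bar>\<nu> j\<bar>) ` R) = \<bar>\<nu> j\<bar>" by auto
  then have max: "\<bar>\<nu> i\<bar> \<le> \<bar>\<nu> j\<bar>" if "i \<in> R" for i
    using fin that by (metis Max_ge finite_imageI imageI)
  have "\<nu> j = - (\<Sum>i\<in>R - {j}. \<nu> i * M i j)"
    using ker[OF j(1)] diag[OF j(1)] sum.remove[OF fin j(1), of "\<lambda>i. \<nu> i * M i j"] by simp
  then have "\<bar>\<nu> j\<bar> \<le> (\<Sum>i\<in>R - {j}. \<bar>\<nu> i\<bar> * \<bar>M i j\<bar>)"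
    using sum_abs[of "\<lambda>i. \<nu> i * M i j" "R - {j}"] by (simp add: abs_mult)
  also have "\<dots> \<le> (\<Sum>i\<in>R - {j}. \<bar>\<nu> j\<bar> * \<bar>M i j\<bar>)"
    using max by (intro sum_mono mult_right_mono) auto
  also have "\<dots> = \<bar>\<nu> j\<bar> * (\<Sum>i\<in>R - {j}. \<bar>M i j\<bar>)"
    by (simp add: sum_distrib_left)
  finally have "\<bar>\<nu> j\<bar> * (1 - (\<Sum>i\<in>R - {j}. \<bar>M i j\<bar>)) \<le> 0"
    by (simp add: algebra_simps)
  then have "\<bar>\<nu> j\<bar> \<le> 0" using dom[OF j(1)] by (simp add: mult_le_0_iff)
  then show ?thesis using max[OF i] by simp
qed

section \<open>Colouring a weighted graph\<close>

text \<open>A greedy choice achieves the average of a random colouring: each new point receives a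
  colour whose added monochromatic weight is at most the mean over all \<open>q\<close>
  colours.\<close>

lemma colouring_with_small_monochromatic_weight:
  fixes w :: "'i \<Rightarrow> 'i \<Rightarrow> real"
  assumes "finite B" "0 < q" "\<And>i. w i i = 0"
  shows "\<exists>f. (\<forall>i\<in>B. f i < q) \<and>
    real q * (\<Sum>i\<in>B. \<Sum>j\<in>B. if f i = f j then w i j else 0) \<le> (\<Sum>i\<in>B. \<Sum>j\<in>B. w i j)"
  using assms(1)
proof (induction B rule: finite_induct)
  case empty
  then show ?case by simp
next
  case (insert x B)
  then obtain f where f: "\<forall>i\<in>B. f i < q"
    "real q * (\<Sum>i\<in>B. \<Sum>j\<in>B. if f i = f j then w i j else 0) \<le> (\<Sum>i\<in>B. \<Sum>j\<in>B. w i j)"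
    by auto
  define g where "g c = (\<Sum>j\<in>B. if f j = c then w x j + w j x else 0)" for c
  define W where "W = (\<Sum>j\<in>B. w x j + w j x)"
  \<comment> \<open>Each old point has exactly one colour, so the costs of the \<open>q\<close>
    choices for \<open>x\<close> add up to its full weight to and from \<open>B\<close>.\<close>
  have sumg: "(\<Sum>c<q. g c) = W"
    unfolding g_def W_def by (subst sum.swap) (use f(1) in \<open>auto intro!: sum.cong\<close>)
  have "\<exists>c<q. real q * g c \<le> W"
  proof (rule ccontr)
    assume "\<not> ?thesis"
    then have "(\<Sum>c<q. W / real q) < (\<Sum>c<q. g c)"
      using assms(2) by (intro sum_strict_mono) (auto simp: field_simps not_le)
    then show False using sumg assms(2) by simp
  qed
  then obtain c where c: "c < q" "real q * g c \<le> W" by auto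
  define h where "h = f(x := c)"
  have hB: "h i = f i" if "i \<in> B" for i using that insert.hyps by (auto simp: h_def)
  have hx: "h x = c" by (simp add: h_def)
  have split: "(\<Sum>i\<in>insert x B. \<Sum>j\<in>insert x B. F i j) =
      F x x + (\<Sum>j\<in>B. F x j + F j x) + (\<Sum>i\<in>B. \<Sum>j\<in>B. F i j)" for F :: "'i \<Rightarrow> 'i \<Rightarrow> real"
    using insert.hyps by (simp add: sum.distrib)
  have "(\<Sum>i\<in>insert x B. \<Sum>j\<in>insert x B. if h i = h j then w i j else 0) =
      g c + (\<Sum>i\<in>B. \<Sum>j\<in>B. if f i = f j then w i j else 0)"
    unfolding split using assms(3)
    by (auto simp: g_def hB hx intro!: sum.cong arg_cong2[where f = "(+)"])
  moreover have "(\<Sum>i\<in>insert x B. \<Sum>j\<in>insert x B. w i j) = W + (\<Sum>i\<in>B. \<Sum>j\<in>B. w i j)"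
    unfolding split W_def using assms(3) by simp
  ultimately show ?case
    using f(1) c f(2) hB hx by (intro exI[of _ h]) (auto simp: distrib_left)
qed

section \<open>Farkas' lemma\<close>

text \<open>
  Bartl's induction on the number of generators: if the new generator \<open>a p\<close> is needed, a vector
  \<open>z\<close> witnessing this has pairing \<open>-1\<close> with it, and all data is projected along \<open>z\<close>
  onto the hyperplane orthogonal to \<open>a p\<close>.
\<close>
lemma farkas:
  fixes a :: "'j \<Rightarrow> 'l \<Rightarrow> real" and b :: "'l \<Rightarrow> real"
  assumes "finite J"
    and "\<And>y. (\<And>j. j \<in> J \<Longrightarrow> 0 \<le> (\<Sum>l\<in>L. y l * a j l)) \<Longrightarrow> 0 \<le> (\<Sum>l\<in>L. y l * b l)"
    and "finite L"
  shows "\<exists>x. (\<forall>j\<in>J. 0 \<le> x j) \<and> (\<forall>l\<in>L. (\<Sum>j\<in>J. x j * a j l) = b l)"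
  using assms(1,2)
proof (induction J arbitrary: a b rule: finite_induct)
  case empty
  \<comment> \<open>Without generators every \<open>y\<close> is admissible, and
    \<open>y = - b\<close> forces \<open>b\<close> to vanish on \<open>L\<close>.\<close>
  have "0 \<le> (\<Sum>l\<in>L. - b l * b l)" by (rule empty) simp
  then have "(\<Sum>l\<in>L. b l * b l) = 0"
    using sum_nonneg[of L "\<lambda>l. b l * b l"] by (simp add: sum_negf)
  then have "\<forall>l\<in>L. b l = 0"
    using assms(3) by (subst (asm) sum_nonneg_eq_0_iff) auto
  then show ?case by simp
next
  case (insert p J)
  define dot where "dot y c = (\<Sum>l\<in>L. y l * c l)" for y c :: "'l \<Rightarrow> real"
  have dot_add_right: "dot y (\<lambda>l. c l + t * d l) = dot y c + t * dot y d" for y c d t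
    by (simp add: dot_def sum.distrib sum_distrib_left algebra_simps)
  have dot_add_left: "dot (\<lambda>l. y l + t * z l) c = dot y c + dot z c * t" for y z c t
    by (simp add: dot_def sum.distrib sum_distrib_left algebra_simps)
  have dot_scale: "dot (\<lambda>l. t * z l) c = t * dot z c" for z c t
    by (simp add: dot_def sum_distrib_left algebra_simps)
  have prem: "0 \<le> dot y b" if "\<And>j. j \<in> insert p J \<Longrightarrow> 0 \<le> dot y (a j)" for y
    using insert.prems[of y] that by (simp add: dot_def)
  show ?case
  proof (cases "\<forall>y. (\<forall>j\<in>J. 0 \<le> dot y (a j)) \<longrightarrow> 0 \<le> dot y b")
    case True
    then obtain x where x: "\<forall>j\<in>J. 0 \<le> x j" "\<forall>l\<in>L. (\<Sum>j\<in>J. x j * a j l) = b l"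
      using insert.IH[of a b] unfolding dot_def by blast
    have "(\<Sum>j\<in>J. (x(p := 0)) j * a j l) = (\<Sum>j\<in>J. x j * a j l)" for l
      using insert.hyps by (intro sum.cong) auto
    with x insert.hyps show ?thesis by (intro exI[of _ "x(p := 0)"]) auto
  next
    case False
    then obtain z0 where z0: "\<forall>j\<in>J. 0 \<le> dot z0 (a j)" "dot z0 b < 0" by (auto simp: not_le)
    have neg: "dot z0 (a p) < 0"
    proof (rule ccontr)
      assume "\<not> ?thesis"
      then have "0 \<le> dot z0 b" using z0(1) by (intro prem) auto
      with z0(2) show False by simp
    qed
    define z where "z = (\<lambda>l. (- 1 / dot z0 (a p)) * z0 l)"
    have zJ: "0 \<le> dot z (a j)" if "j \<in> J" for j
      unfolding z_def dot_scale using z0(1) neg that by (intro mult_nonneg_nonneg) (auto simp: divide_simps)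
    have zb: "dot z b < 0"
      unfolding z_def dot_scale using z0(2) neg by (intro mult_pos_neg) (auto simp: divide_simps)
    have zp: "dot z (a p) = - 1"
      unfolding z_def dot_scale using neg by simp
    \<comment> \<open>Since \<open>dot z (a p) = - 1\<close>, adding these multiples of
      \<open>a p\<close> makes every vector orthogonal to \<open>z\<close>. Dually, \<open>y\<close>
      is moved along \<open>z\<close> until it is orthogonal to \<open>a p\<close>; the pairings of
      the moved \<open>y\<close> with the old vectors are those of \<open>y\<close> with the new
      ones.\<close>
    define a' where "a' j = (\<lambda>l. a j l + dot z (a j) * a p l)" for j
    define b' where "b' = (\<lambda>l. b l + dot z b * a p l)"
    have "0 \<le> dot y b'" if y: "\<And>j. j \<in> J \<Longrightarrow> 0 \<le> dot y (a' j)" for y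
    proof -
      have "0 \<le> dot (\<lambda>l. y l + dot y (a p) * z l) b"
      proof (rule prem)
        fix j assume "j \<in> insert p J"
        then show "0 \<le> dot (\<lambda>l. y l + dot y (a p) * z l) (a j)"
          unfolding dot_add_left using y[of j] zp
          by (auto simp: a'_def dot_add_right)
      qed
      then show ?thesis unfolding dot_add_left b'_def dot_add_right .
    qed
    then obtain x where x: "\<forall>j\<in>J. 0 \<le> x j" "\<forall>l\<in>L. (\<Sum>j\<in>J. x j * a' j l) = b' l"
      using insert.IH[of a' b'] unfolding dot_def by blast
    \<comment> \<open>Undoing the projection collects this coefficient of \<open>a p\<close>; it is
      nonnegative by \<open>zJ\<close> and \<open>zb\<close>.\<close>
    define s where "s = (\<Sum>j\<in>J. x j * dot z (a j)) - dot z b"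
    have s: "0 \<le> s"
    proof -
      have "0 \<le> (\<Sum>j\<in>J. x j * dot z (a j))"
        using x(1) zJ by (intro sum_nonneg mult_nonneg_nonneg) auto
      with zb show ?thesis by (simp add: s_def)
    qed
    have "(\<Sum>j\<in>insert p J. (x(p := s)) j * a j l) = b l" if "l \<in> L" for l
    proof -
      have "(\<Sum>j\<in>J. (x(p := s)) j * a j l) = (\<Sum>j\<in>J. x j * a j l)"
        using insert.hyps by (intro sum.cong) auto
      moreover have "(\<Sum>j\<in>J. x j * a j l) + (\<Sum>j\<in>J. x j * dot z (a j)) * a p l =
          b l + dot z b * a p l"
        using x(2) that
        by (auto simp: a'_def b'_def distrib_left sum.distrib sum_distrib_right mult.assoc)
      ultimately show ?thesis
        using insert.hyps by (simp add: s_def algebra_simps)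
    qed
    with x(1) s insert.hyps show ?thesis by (intro exI[of _ "x(p := s)"]) auto
  qed
qed

section \<open>Counting the bad indices\<close>

text \<open>At most a quarter of \<open>B\<close> lies in heavy columns. The rest splits into at
  most \<open>5 * T\<close> colour classes, each of size at most \<open>card L\<close> because
  \<open>M\<close> factors through \<open>L\<close>. Hence three quarters of \<open>card B\<close>
  is at most \<open>5 * T * card L\<close>.\<close>

lemma card_le_if_spiked_rows:
  fixes y :: "'i \<Rightarrow> 'l \<Rightarrow> real" and a :: "'i \<Rightarrow> 'l \<Rightarrow> real" and L :: "'l set"
  defines "M \<equiv> \<lambda>i j. \<Sum>l\<in>L. y i l * a j l"
  assumes finL: "finite L" and finB: "finite B" and T: "1 \<le> T"
    and diag: "\<And>i. i \<in> B \<Longrightarrow> M i i = 1"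
    and off: "\<And>i. i \<in> B \<Longrightarrow> (\<Sum>j\<in>B - {i}. \<bar>M i j\<bar>) \<le> T"
  shows "3 * real (card B) \<le> 20 * T * real (card L)"
proof -
  \<comment> \<open>The total weight is at most \<open>T * card B\<close>, so \<open>4 * T\<close>
    colours leave at most a quarter of \<open>card B\<close> inside the classes;
    \<open>T \<ge> 1\<close> absorbs the rounding into \<open>5 * T\<close>.\<close>
  define q where "q = nat \<lceil>4 * T\<rceil>"
  have q: "4 * T \<le> real q" "real q \<le> 5 * T" "0 < q"
    using T unfolding q_def by linarith+
  define w where "w i j = (if i = j then 0 else \<bar>M i j\<bar>)" for i j
  obtain f where f: "\<forall>i\<in>B. f i < q" and
    fw: "real q * (\<Sum>i\<in>B. \<Sum>j\<in>B. if f i = f j then w i j else 0) \<le> (\<Sum>i\<in>B. \<Sum>j\<in>B. w i j)"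
    using colouring_with_small_monochromatic_weight[OF finB q(3), of w] by (auto simp: w_def)
  have w_nonneg: "0 \<le> w i j" for i j by (simp add: w_def)
  define W where "W = (\<Sum>i\<in>B. \<Sum>j\<in>B. if f i = f j then w i j else 0)"
  have W_nonneg: "0 \<le> W" unfolding W_def using w_nonneg by (intro sum_nonneg) auto
  have "(\<Sum>i\<in>B. \<Sum>j\<in>B. w i j) \<le> (\<Sum>i\<in>B. T)"
  proof (rule sum_mono)
    fix i assume i: "i \<in> B"
    have "(\<Sum>j\<in>B. w i j) = (\<Sum>j\<in>B - {i}. w i j)"
      using sum.remove[OF finB i, of "w i"] by (simp add: w_def)
    also have "\<dots> = (\<Sum>j\<in>B - {i}. \<bar>M i j\<bar>)"
      by (intro sum.cong) (auto simp: w_def)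
    finally have "(\<Sum>j\<in>B. w i j) = (\<Sum>j\<in>B - {i}. \<bar>M i j\<bar>)" .
    with off[OF i] show "(\<Sum>j\<in>B. w i j) \<le> T" by simp
  qed
  with fw have "real q * W \<le> real (card B) * T" by (simp add: W_def)
  moreover have "4 * T * W \<le> real q * W" using q(1) W_nonneg by (rule mult_right_mono)
  ultimately have "T * (4 * W) \<le> T * real (card B)" by (simp add: algebra_simps)
  then have W_le: "4 * W \<le> real (card B)" using T by simp
  define col where "col j = (\<Sum>i\<in>B. if f i = f j then w i j else 0)" for j
  have col_nonneg: "0 \<le> col j" for j unfolding col_def using w_nonneg by (intro sum_nonneg) auto
  \<comment> \<open>Markov's inequality: the column weights \<open>col j\<close> sum to at most a
    quarter of \<open>card B\<close>, which bounds the number of columns of weight at least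
    1.\<close>
  define D where "D = {j\<in>B. 1 \<le> col j}"
  have "real (card D) = (\<Sum>j\<in>D. 1)" by simp
  also have "\<dots> \<le> (\<Sum>j\<in>D. col j)" by (intro sum_mono) (auto simp: D_def)
  also have "\<dots> \<le> (\<Sum>j\<in>B. col j)"
    using finB col_nonneg by (intro sum_mono2) (auto simp: D_def)
  also have "\<dots> = W" unfolding col_def W_def by (rule sum.swap)
  finally have D_le: "4 * real (card D) \<le> real (card B)" using W_le by simp
  define R where "R c = {j \<in> B - D. f j = c}" for c
  have R_card: "card (R c) \<le> card L" for c
  proof (rule ccontr)
    assume "\<not> ?thesis"
    then have less: "card L < card (R c)" by simp
    have fin: "finite (R c)" using finB by (simp add: R_def)
    obtain \<nu> where nz: "\<exists>i\<in>R c. \<nu> i \<noteq> 0"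
      and rel: "\<forall>l\<in>L. (\<Sum>i\<in>R c. \<nu> i * y i l) = 0"
      using underdetermined_nontrivial_solution[OF finL fin less, of y] by auto
    \<comment> \<open>A relation among the coefficient vectors \<open>y i\<close> carries over to
      the rows of \<open>M\<close>, contradicting dominance.\<close>
    have ker: "(\<Sum>i\<in>R c. \<nu> i * M i j) = 0" for j
    proof -
      have "(\<Sum>i\<in>R c. \<nu> i * M i j) = (\<Sum>l\<in>L. (\<Sum>i\<in>R c. \<nu> i * y i l) * a j l)"
        unfolding M_def sum_distrib_left sum_distrib_right
        by (subst sum.swap) (simp add: mult.assoc)
      with rel show ?thesis by simp
    qed
    have dom: "(\<Sum>i\<in>R c - {j}. \<bar>M i j\<bar>) < 1" if j: "j \<in> R c" for j
    proof -
      have "(\<Sum>i\<in>R c - {j}. \<bar>M i j\<bar>) = (\<Sum>i\<in>R c - {j}. if f i = f j then w i j else 0)"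
        using j by (intro sum.cong) (auto simp: R_def w_def)
      also have "\<dots> \<le> col j"
        unfolding col_def using finB w_nonneg by (intro sum_mono2) (auto simp: R_def)
      also have "\<dots> < 1" using j by (auto simp: R_def D_def)
      finally show ?thesis .
    qed
    have "\<nu> i = 0" if "i \<in> R c" for i
      using strictly_column_dominant_imp_trivial_left_kernel[OF fin _ dom ker that] diag
      by (auto simp: R_def)
    with nz show False by auto
  qed
  have "B - D = (\<Union>c<q. R c)" using f by (auto simp: R_def)
  then have "card (B - D) \<le> (\<Sum>c<q. card (R c))" by (simp add: card_UN_le)
  also have "\<dots> \<le> (\<Sum>c<q. card L)" using R_card by (intro sum_mono) auto
  finally have "real (card (B - D)) \<le> real q * real (card L)"
    by (simp flip: of_nat_mult)
  also have "\<dots> \<le> 5 * T * real (card L)" using q(2) by (intro mult_right_mono) auto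
  finally have "real (card (B - D)) \<le> 5 * T * real (card L)" .
  moreover have "real (card (B - D)) = real (card B) - real (card D)"
    using finB by (subst card_Diff_subset) (auto simp: D_def card_mono intro!: of_nat_diff)
  ultimately show ?thesis using D_le by (simp add: algebra_simps)
qed

section \<open>Duality for a single index, and the conclusion\<close>

text \<open>Farkas' lemma is applied to the columns other than \<open>i\<close>, which encodes the
  condition that \<open>x\<close> vanishes at \<open>i\<close>. If it yields no \<open>x\<close>,
  the separating \<open>z\<close> gives a row combination \<open>u\<close> that is nonnegative off
  \<open>i\<close> and pairs negatively with the spike vector.\<close>

lemma spike_vec_alternative:
  fixes A :: "real mat"
  assumes A: "A \<in> carrier_mat k n" and i: "i < n" and T: "0 < T"
  shows "(\<exists>x\<in>carrier_vec n. A *\<^sub>v x = A *\<^sub>v spike_vec n T i \<and> (\<forall>j<n. 0 \<le> x $ j) \<and> x $ i = 0) \<or>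
    (\<exists>y. (\<Sum>l<k. y l * A $$ (l, i)) = 1 \<and>
      (\<Sum>j\<in>{..<n} - {i}. \<bar>\<Sum>l<k. y l * A $$ (l, j)\<bar>) \<le> T)"
proof -
  define v where "v j = (if j = i then 1 else 1 / T)" for j
  define J where "J = {..<n} - {i}"
  have n: "{..<n} = insert i J" "i \<notin> J" "finite J" using i by (auto simp: J_def)
  define b where "b l = (\<Sum>j<n. A $$ (l, j) * v j)" for l
  have mult: "(A *\<^sub>v x) $ l = (\<Sum>j<n. A $$ (l, j) * x $ j)" if "l < k" "x \<in> carrier_vec n" for l x
    using that A by (auto simp: scalar_prod_def atLeast0LessThan intro!: sum.cong)
  show ?thesis
  proof (cases "\<forall>y. (\<forall>j\<in>J. 0 \<le> (\<Sum>l<k. y l * A $$ (l, j))) \<longrightarrow> 0 \<le> (\<Sum>l<k. y l * b l)")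
    case True
    obtain x where x: "\<forall>j\<in>J. 0 \<le> x j" "\<forall>l\<in>{..<k}. (\<Sum>j\<in>J. x j * A $$ (l, j)) = b l"
      using farkas[OF n(3), where L = "{..<k}" and a = "\<lambda>j l. A $$ (l, j)" and b = b] True by blast
    define x' where "x' = vec n (\<lambda>j. if j = i then 0 else x j)"
    have x': "x' \<in> carrier_vec n" by (simp add: x'_def)
    have "A *\<^sub>v x' = A *\<^sub>v spike_vec n T i"
    proof (rule eq_vecI)
      fix l assume "l < dim_vec (A *\<^sub>v spike_vec n T i)"
      then have l: "l < k" using A by simp
      have "(A *\<^sub>v x') $ l = (\<Sum>j<n. A $$ (l, j) * (if j = i then 0 else x j))"
        unfolding mult[OF l x'] by (intro sum.cong) (auto simp: x'_def)
      also have "\<dots> = (\<Sum>j\<in>J. x j * A $$ (l, j))"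
        unfolding n(1) using n(2,3) by (auto intro!: sum.cong)
      also have "\<dots> = b l" using x(2) l by simp
      also have "\<dots> = (A *\<^sub>v spike_vec n T i) $ l"
        unfolding b_def by (subst mult[OF l]) (auto simp: spike_vec_def v_def)
      finally show "(A *\<^sub>v x') $ l = (A *\<^sub>v spike_vec n T i) $ l" .
    qed (use A in simp)
    moreover have "\<forall>j<n. 0 \<le> x' $ j" using x(1) by (auto simp: x'_def J_def)
    moreover have "x' $ i = 0" using i by (simp add: x'_def)
    ultimately show ?thesis using x' by blast
  next
    case False
    then obtain z where z: "\<forall>j\<in>J. 0 \<le> (\<Sum>l<k. z l * A $$ (l, j))" "(\<Sum>l<k. z l * b l) < 0"
      by (auto simp: not_le)
    define u where "u j = (\<Sum>l<k. z l * A $$ (l, j))" for j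
    have "(\<Sum>l<k. z l * b l) = (\<Sum>j<n. u j * v j)"
      unfolding b_def u_def sum_distrib_left sum_distrib_right
      by (subst sum.swap) (simp add: mult.assoc)
    also have "\<dots> = u i + (\<Sum>j\<in>J. u j * v j)"
      unfolding n(1) using n(2,3) by (simp add: v_def)
    also have "(\<Sum>j\<in>J. u j * v j) = (\<Sum>j\<in>J. u j) / T"
      unfolding sum_divide_distrib using n(2) by (intro sum.cong) (auto simp: v_def)
    finally have neg: "u i + (\<Sum>j\<in>J. u j) / T < 0" using z(2) by simp
    have nonneg: "0 \<le> u j" if "j \<in> J" for j using z(1) that by (simp add: u_def)
    then have "0 \<le> (\<Sum>j\<in>J. u j) / T" using T by (intro divide_nonneg_pos sum_nonneg) auto
    \<comment> \<open>The off-diagonal part is nonnegative, so only \<open>u i\<close> can make the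
      pairing negative; \<open>neg\<close> then also bounds the off-diagonal sum by
      \<open>T * (- u i)\<close>, and division by \<open>u i\<close> normalises the spike to
      1.\<close>
    with neg have ui: "u i < 0" by linarith
    define y where "y l = z l / u i" for l
    have y: "(\<Sum>l<k. y l * A $$ (l, j)) = u j / u i" for j
      by (simp add: y_def u_def sum_divide_distrib)
    have "(\<Sum>j\<in>J. \<bar>u j / u i\<bar>) = (\<Sum>j\<in>J. u j) / (- u i)"
      unfolding sum_divide_distrib using nonneg ui by (intro sum.cong) (auto simp: abs_div)
    also have "\<dots> \<le> T" using neg ui T by (simp add: field_simps)
    finally have "(\<Sum>j\<in>J. \<bar>u j / u i\<bar>) \<le> T" .
    then show ?thesis using ui by (intro disjI2 exI[of _ y]) (simp add: y J_def)
  qed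
qed

theorem mainTheorem7:
  "\<exists>c::real. c > 0 \<and>
    (\<forall>(n::nat) (T::real) (k::nat) (A::real mat).
       1 \<le> T \<longrightarrow> T \<le> real n / 2 \<longrightarrow>
       real k \<le> c * real n / T \<longrightarrow>
       A \<in> carrier_mat k n \<longrightarrow>
       (\<exists>S. S \<subseteq> {..<n} \<and> int (card S) = \<lceil>real n / 2\<rceil> \<and>
          (\<forall>i\<in>S. \<exists>x\<in>carrier_vec n.
             A *\<^sub>v x = A *\<^sub>v spike_vec n T i \<and>
             (\<forall>j<n. 0 \<le> x $ j) \<and> x $ i = 0)))"
proof (intro exI[of _ "1 / 20"] conjI allI impI)
  fix n :: nat and T :: real and k :: nat and A :: "real mat"
  assume T: "1 \<le> T" and Tn: "T \<le> real n / 2" and k: "real k \<le> 1 / 20 * real n / T"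
    and A: "A \<in> carrier_mat k n"
  define P where "P i \<longleftrightarrow> (\<exists>x\<in>carrier_vec n.
      A *\<^sub>v x = A *\<^sub>v spike_vec n T i \<and> (\<forall>j<n. 0 \<le> x $ j) \<and> x $ i = 0)" for i
  define B where "B = {i. i < n \<and> \<not> P i}"
  define G where "G = {i. i < n \<and> P i}"
  have "\<forall>i\<in>B. \<exists>y. (\<Sum>l<k. y l * A $$ (l, i)) = 1 \<and>
      (\<Sum>j\<in>{..<n} - {i}. \<bar>\<Sum>l<k. y l * A $$ (l, j)\<bar>) \<le> T"
    using spike_vec_alternative[OF A, of _ T] T unfolding B_def P_def by force
  from bchoice[OF this] obtain y where
    y: "\<And>i. i \<in> B \<Longrightarrow> (\<Sum>l<k. y i l * A $$ (l, i)) = 1"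
      "\<And>i. i \<in> B \<Longrightarrow> (\<Sum>j\<in>{..<n} - {i}. \<bar>\<Sum>l<k. y i l * A $$ (l, j)\<bar>) \<le> T"
    by blast
  have "3 * real (card B) \<le> 20 * T * real (card {..<k})"
  proof (rule card_le_if_spiked_rows[where y = y and a = "\<lambda>j l. A $$ (l, j)"])
    fix i assume i: "i \<in> B"
    have "(\<Sum>j\<in>B - {i}. \<bar>\<Sum>l<k. y i l * A $$ (l, j)\<bar>) \<le>
        (\<Sum>j\<in>{..<n} - {i}. \<bar>\<Sum>l<k. y i l * A $$ (l, j)\<bar>)"
      by (intro sum_mono2) (auto simp: B_def)
    with y(2)[OF i] show "(\<Sum>j\<in>B - {i}. \<bar>\<Sum>l<k. y i l * A $$ (l, j)\<bar>) \<le> T" by linarith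
  qed (use T y(1) in \<open>auto simp: B_def\<close>)
  \<comment> \<open>The constant \<open>1 / 20\<close> cancels the factor 20 of the counting bound,
    leaving at most a third of the indices bad.\<close>
  moreover have "20 * T * real k \<le> real n" using k T by (simp add: field_simps)
  ultimately have "3 * card B \<le> n" by simp
  moreover have "card B + card G = n"
  proof -
    have "card (B \<union> G) = card B + card G" by (rule card_Un_disjoint) (auto simp: B_def G_def)
    moreover have "B \<union> G = {..<n}" by (auto simp: B_def G_def)
    ultimately show ?thesis by simp
  qed
  ultimately have "2 * n \<le> 3 * card G" by linarith
  moreover have "2 \<le> n" using T Tn by linarith
  \<comment> \<open>Two thirds of \<open>n\<close> cover the rounded-up half: for
    \<open>n \<ge> 3\<close> they are at least \<open>(n + 1) / 2\<close>, and for
    \<open>n = 2\<close> one index suffices.\<close>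
  ultimately have "nat \<lceil>real n / 2\<rceil> \<le> card G" by linarith
  then obtain S where S: "S \<subseteq> G" "card S = nat \<lceil>real n / 2\<rceil>"
    by (rule obtain_subset_with_card_n)
  then have "int (card S) = \<lceil>real n / 2\<rceil>" by simp
  with S(1) show "\<exists>S. S \<subseteq> {..<n} \<and> int (card S) = \<lceil>real n / 2\<rceil> \<and>
      (\<forall>i\<in>S. \<exists>x\<in>carrier_vec n. A *\<^sub>v x = A *\<^sub>v spike_vec n T i \<and>
        (\<forall>j<n. 0 \<le> x $ j) \<and> x $ i = 0)"
    unfolding G_def P_def by (intro exI[of _ S]) auto
qed simp

end
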